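(* Let $G$ be a GSOS language such that $\{\mathrm{init}(p)\mid p \text{ a closed } \Sigma_G\text{-term}\}=2^{\mathsf{Act}}$. Then for all $P,Q\in\mathbb{T}(\Sigma_G)$, $P\mathrel{\underline{\leftrightarrow}}^{RM}_G Q$ implies $\mathbb{C}(G)\models P=Q$, i.e., for every disjoint extension $G'$ of $G$ and every closed $\Sigma_{G'}$-substitution $\sigma$, $P\sigma\mathrel{\underline{\leftrightarrow}}_{G'}Q\sigma$.
   Context: Let $\mathit{Var}$ be a countably infinite set of variables and $\mathsf{Act}$ a fixed nonempty finite set of actions. A signature $\Sigma$ is a set of operation symbols each with an arity; $\mathbb{T}(\Sigma)$ is the set of terms over $\Sigma$ and $\mathit{Var}$; closed terms have no variables. A GSOS rule over $\Sigma$ has the form $$\frac{\bigcup_{i=1}^{l}\{x_i \xrightarrow{a_{ij}} y_{ij} \mid 1\le j\le m_i\}\ \cup\ \bigcup_{i=1}^{l}\{x_i \not\xrightarrow{b_{ik}} \mid 1\le k\le n_i\}}{f(x_1,\dots,x_l)\xrightarrow{c} C[\vec x,\vec y]}$$ with all variables distinct, $a_{ij},b_{ik},c\in\mathsf{Act}$, $f$ of arity $l$, $C$ a term with variables among $\vec x,\vec y$. A GSOS language $G=(\Sigma_G,R_G)$ is a finite signature with a finite set of GSOS rules; its transition relation $\to_G$ on closed terms is defined by structural induction: $f(\vec p)\xrightarrow{c}_G q$ iff some rule with principal operation $f$ and action $c$ and some closed substitution $\sigma$ with $\sigma(x_i)=p_i$ satisfy all antecedents ($\sigma(x_i)\xrightarrow{a_{ij}}_G\sigma(y_{ij})$;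 $\sigma(x_i)$ has no $b_{ik}$-transition) and $q=C\sigma$. For a closed term $p$, $\mathrm{init}(p)=\{a\in\mathsf{Act}\mid\exists q:\ p\xrightarrow{a}_G q\}$. A symmetric relation on closed terms is a bisimulation if related $p,q$ and $p\xrightarrow{a}p'$ imply $q\xrightarrow{a}q'$ with $p',q'$ related; $\mathrel{\underline{\leftrightarrow}}_G$ is bisimilarity. A GSOS language $G'$ is a disjoint extension of $G$ if its signature and rules include those of $G$ and it has no new rules whose principal operation is in $\Sigma_G$. $\mathbb{C}(G)\models P=Q$ means that for every disjoint extension $G'$ of $G$, $P\sigma\mathrel{\underline{\leftrightarrow}}_{G'}Q\sigma$ for all closed $\Sigma_{G'}$-substitutions $\sigma$. Ruloids: a ruloid for a term $D$ has the shape of a GSOS rule but with source $D$ (all variables distinct); sourcevars are the $x_i$, targetvars the $y_{ij}$; $\mathrm{ante}(\rho)$ is its set of antecedents. It is sound if every closed substitution satisfying its antecedents yields a transition of $\to_G$ when applied to its consequent; a set of ruloids is supporting for $D$ and $c$ if its consequents are $D\xrightarrow{c}\cdot$ and every closed transition $D[\vec p]\xrightarrow{c}p$ arises by instantiating one of them with a closed substitution satisfying its antecedents. For each term $P$, $\mathrm{ruloids}(P)$ is a fixed finite set of ruloids, the union over $c$ of finite sets sound and supporting for $P$ and $c$. A ruloid $\rho=\frac{H}{P\xrightarrow{a}P'}$ is valid for $P$ iff $\rho=\rho'\sigma$ for some $\rho'\in\mathrm{ruloids}(P)$ and injective $\sigma:\mathrm{targetvars}(\rho')\to\mathit{Var}\setminus\mathrm{sourcevars}(\rho)$.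 Initial transition formulae: $F::=\mathsf{True}\mid x\xrightarrow{a}\mid\neg F\mid F\wedge F$; a closed substitution $\sigma$ satisfies $x\xrightarrow{a}$ iff $\sigma(x)\xrightarrow{a}_G p$ for some $p$; $\models_G F\Rightarrow F'$ iff every closed $\Sigma_G$-substitution satisfying $F$ satisfies $F'$. $\mathrm{hyps}(H)$ for a set of transition formulae is the conjunction of $x\xrightarrow{a}$ for $x\xrightarrow{a}y\in H$ and $\neg(x\xrightarrow{b})$ for $x\not\xrightarrow{b}\in H$; $\mathrm{hyps}(\rho)=\mathrm{hyps}(\mathrm{ante}(\rho))$; $\mathrm{hyps}(J)=\bigvee_{\rho'\in J}\mathrm{hyps}(\mathrm{ante}(\rho'))$. A symmetric relation $\approx$ on $\mathbb{T}(\Sigma_G)$ is a rule-matching bisimulation if $P\approx Q$ implies: for each $\rho=\frac{H}{P\xrightarrow{a}P'}\in\mathrm{ruloids}(P)$ there is a finite set $J$ of valid ruloids for $Q$ such that (1) for every $\rho'=\frac{H'}{Q\xrightarrow{a'}Q'}\in J$: (a) $a'=a$; (b) $P'\approx Q'$; (c) $(\mathrm{targetvars}(\rho')\cup\mathrm{targetvars}(\rho))\cap(\mathrm{sourcevars}(\rho)\cup\mathrm{sourcevars}(\rho'))=\emptyset$; (d) if $y\in\mathrm{targetvars}(\rho)\cap\mathrm{targetvars}(\rho')$ then $x\xrightarrow{b}y\in H\cap H'$ for some $x\in\mathrm{sourcevars}(\rho)\cap\mathrm{sourcevars}(\rho')$ and action $b$; and (2) $\models_G\mathrm{hyps}(\rho)\Rightarrow\mathrm{hyps}(J)$.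 $P\mathrel{\underline{\leftrightarrow}}^{RM}_G Q$ iff some rule-matching bisimulation (for $G$) relates $P$ and $Q$. Standing assumption: $G$ contains no junk rules (rules supporting no transition of $\to_G$), and the ruloid sets considered contain no junk ruloids.
   Formalization: The fixed sets ruloids(P) are required to be sound and supporting in every disjoint extension of G, not only for the transition relation of G; with the latter alone the claim fails for some choices of ruloids(P). *)

theory Defs
  imports Main
begin

type_synonym var = nat

datatype 'f trm = Var var | Op 'f "'f trm list"

primrec vars :: "'f trm \<Rightarrow> var set" where
  "vars (Var x) = {x}"
| "vars (Op f ts) = \<Union> (set (map vars ts))"

primrec subst :: "(var \<Rightarrow> 'f trm) \<Rightarrow> 'f trm \<Rightarrow> 'f trm" where
  "subst \<sigma> (Var x) = \<sigma> x"
| "subst \<sigma> (Op f ts) = Op f (map (subst \<sigma>) ts)"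

text \<open>A signature maps each of its operation symbols to its arity.\<close>

type_synonym 'f signature = "'f \<rightharpoonup> nat"

inductive_set terms :: "'f signature \<Rightarrow> 'f trm set" for \<Sigma> where
  "Var x \<in> terms \<Sigma>"
| "\<Sigma> f = Some (length ts) \<Longrightarrow> (\<And>t. t \<in> set ts \<Longrightarrow> t \<in> terms \<Sigma>) \<Longrightarrow> Op f ts \<in> terms \<Sigma>"

definition closed_terms :: "'f signature \<Rightarrow> 'f trm set" where
  "closed_terms \<Sigma> = {t \<in> terms \<Sigma>. vars t = {}}"

text \<open>Antecedents: \<open>Pos x a y\<close> is the transition formula from x to y with label a, and
  \<open>Neg x b\<close> says that x has no b-transition.\<close>

datatype 'a antecedent = Pos var 'a var | Neg var 'a

text \<open>GSOS rules and ruloids have the same shape; a GSOS rule is a ruloid whose source is an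
  operation symbol applied to distinct variables.\<close>

record ('f, 'a) ruloid =
  ante :: "'a antecedent set"
  source :: "'f trm"
  label :: 'a
  target :: "'f trm"

record ('f, 'a) gsos =
  sig :: "'f signature"
  rules :: "('f, 'a) ruloid set"

definition sourcevars :: "('f, 'a) ruloid \<Rightarrow> var set" where
  "sourcevars \<rho> = vars (source \<rho>)"

definition targetvars :: "('f, 'a) ruloid \<Rightarrow> var set" where
  "targetvars \<rho> = {y. \<exists>x a. Pos x a y \<in> ante \<rho>}"

text \<open>The antecedents form a set rather than a doubly indexed family, so distinctness of the
  target variables says that the target variable of a positive antecedent determines it.\<close>

definition ruloid_for :: "'f signature \<Rightarrow> 'f trm \<Rightarrow> ('f, 'a) ruloid \<Rightarrow> bool" where
  "ruloid_for \<Sigma> D \<rho> \<longleftrightarrow>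
     source \<rho> = D \<and> D \<in> terms \<Sigma> \<and> target \<rho> \<in> terms \<Sigma> \<and> finite (ante \<rho>) \<and>
     (\<forall>x a y. Pos x a y \<in> ante \<rho> \<longrightarrow> x \<in> sourcevars \<rho>) \<and>
     (\<forall>x b. Neg x b \<in> ante \<rho> \<longrightarrow> x \<in> sourcevars \<rho>) \<and>
     targetvars \<rho> \<inter> sourcevars \<rho> = {} \<and>
     (\<forall>x a x' a' y. Pos x a y \<in> ante \<rho> \<and> Pos x' a' y \<in> ante \<rho> \<longrightarrow> x = x' \<and> a = a') \<and>
     vars (target \<rho>) \<subseteq> sourcevars \<rho> \<union> targetvars \<rho>"

definition gsos_rule :: "'f signature \<Rightarrow> ('f, 'a) ruloid \<Rightarrow> bool" where
  "gsos_rule \<Sigma> \<rho> \<longleftrightarrow> (\<exists>f xs. distinct xs \<and> ruloid_for \<Sigma> (Op f (map Var xs)) \<rho>)"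

definition gsos_language :: "('f, 'a) gsos \<Rightarrow> bool" where
  "gsos_language G \<longleftrightarrow>
     finite (dom (sig G)) \<and> finite (rules G) \<and> (\<forall>\<rho>\<in>rules G. gsos_rule (sig G) \<rho>)"

definition closed_subst :: "('f, 'a) gsos \<Rightarrow> (var \<Rightarrow> 'f trm) \<Rightarrow> bool" where
  "closed_subst G \<sigma> \<longleftrightarrow> (\<forall>x. \<sigma> x \<in> closed_terms (sig G))"

text \<open>The guards \<open>x \<in> set xs\<close> make the recursion structural; they hold automatically for the rules
  of a GSOS language (see \<open>step_iff_supports\<close> below).\<close>

declare conj_cong [fundef_cong]

function step :: "('f, 'a) gsos \<Rightarrow> 'f trm \<Rightarrow> 'a \<Rightarrow> 'f trm \<Rightarrow> bool" where
  "step G (Var x) c q \<longleftrightarrow> False"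
| "step G (Op f ps) c q \<longleftrightarrow>
     (\<exists>\<rho>\<in>rules G. \<exists>xs \<sigma>. closed_subst G \<sigma> \<and> source \<rho> = Op f (map Var xs) \<and> ps = map \<sigma> xs \<and>
        label \<rho> = c \<and> q = subst \<sigma> (target \<rho>) \<and>
        (\<forall>x a y. x \<in> set xs \<and> Pos x a y \<in> ante \<rho> \<longrightarrow> step G (\<sigma> x) a (\<sigma> y)) \<and>
        (\<forall>x b. x \<in> set xs \<and> Neg x b \<in> ante \<rho> \<longrightarrow> (\<nexists>r. step G (\<sigma> x) b r)))"
  by pat_completeness auto
termination
proof (relation "measure (\<lambda>(G, p, c, q). size p)", goal_cases)
  case 1
  show ?case by simp
next
  case (2 G f ps c q \<rho> xs \<sigma> x a y)
  then have "\<sigma> x \<in> set ps" by auto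
  then have "size (\<sigma> x) \<le> size_list size ps" by (rule size_list_estimation') simp
  then show ?case by simp
next
  case (3 G f ps c q \<rho> xs \<sigma> x b r)
  then have "\<sigma> x \<in> set ps" by auto
  then have "size (\<sigma> x) \<le> size_list size ps" by (rule size_list_estimation') simp
  then show ?case by simp
qed

declare conj_cong [fundef_cong del] step.simps(2) [simp del]

definition init :: "('f, 'a) gsos \<Rightarrow> 'f trm \<Rightarrow> 'a set" where
  "init G p = {a. \<exists>q. step G p a q}"

fun sat_ante :: "('f, 'a) gsos \<Rightarrow> (var \<Rightarrow> 'f trm) \<Rightarrow> 'a antecedent \<Rightarrow> bool" where
  "sat_ante G \<sigma> (Pos x a y) \<longleftrightarrow> step G (\<sigma> x) a (\<sigma> y)"
| "sat_ante G \<sigma> (Neg x b) \<longleftrightarrow> (\<nexists>r. step G (\<sigma> x) b r)"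

definition supports :: "('f, 'a) gsos \<Rightarrow> ('f, 'a) ruloid \<Rightarrow> 'f trm \<Rightarrow> 'a \<Rightarrow> 'f trm \<Rightarrow> bool" where
  "supports G \<rho> p c q \<longleftrightarrow>
     (\<exists>\<sigma>. closed_subst G \<sigma> \<and> (\<forall>\<phi>\<in>ante \<rho>. sat_ante G \<sigma> \<phi>) \<and>
          p = subst \<sigma> (source \<rho>) \<and> c = label \<rho> \<and> q = subst \<sigma> (target \<rho>))"

lemma step_iff_supports:
  assumes "gsos_language G"
  shows "step G (Op f ps) c q \<longleftrightarrow> (\<exists>\<rho>\<in>rules G. supports G \<rho> (Op f ps) c q)"
proof
  assume "step G (Op f ps) c q"
  then obtain \<rho> xs \<sigma> where *: "\<rho> \<in> rules G" "closed_subst G \<sigma>" "source \<rho> = Op f (map Var xs)"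
    "ps = map \<sigma> xs" "label \<rho> = c" "q = subst \<sigma> (target \<rho>)"
    "\<And>x a y. x \<in> set xs \<Longrightarrow> Pos x a y \<in> ante \<rho> \<Longrightarrow> step G (\<sigma> x) a (\<sigma> y)"
    "\<And>x b. x \<in> set xs \<Longrightarrow> Neg x b \<in> ante \<rho> \<Longrightarrow> (\<nexists>r. step G (\<sigma> x) b r)"
    unfolding step.simps(2) by blast
  have v: "sourcevars \<rho> = set xs"
    unfolding sourcevars_def *(3) by (induction xs) simp_all
  have r: "ruloid_for (sig G) (source \<rho>) \<rho>"
    using assms \<open>\<rho> \<in> rules G\<close> unfolding gsos_language_def gsos_rule_def ruloid_for_def by metis
  have "\<And>x a y. Pos x a y \<in> ante \<rho> \<Longrightarrow> x \<in> set xs" "\<And>x b. Neg x b \<in> ante \<rho> \<Longrightarrow> x \<in> set xs"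
    using r v unfolding ruloid_for_def by blast+
  then have "sat_ante G \<sigma> \<phi>" if "\<phi> \<in> ante \<rho>" for \<phi>
    using that *(7,8) by (cases \<phi>) simp_all
  then have "supports G \<rho> (Op f ps) c q"
    using *(2-6) unfolding supports_def by (intro exI[of _ \<sigma>]) (simp add: comp_def)
  then show "\<exists>\<rho>\<in>rules G. supports G \<rho> (Op f ps) c q"
    using *(1) by blast
next
  assume "\<exists>\<rho>\<in>rules G. supports G \<rho> (Op f ps) c q"
  then obtain \<rho> \<sigma> where *: "\<rho> \<in> rules G" "closed_subst G \<sigma>" "\<forall>\<phi>\<in>ante \<rho>. sat_ante G \<sigma> \<phi>"
    "Op f ps = subst \<sigma> (source \<rho>)" "c = label \<rho>" "q = subst \<sigma> (target \<rho>)"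
    unfolding supports_def by blast
  obtain g xs where g: "source \<rho> = Op g (map Var xs)"
    using assms \<open>\<rho> \<in> rules G\<close> unfolding gsos_language_def gsos_rule_def ruloid_for_def by metis
  have "f = g" "ps = map \<sigma> xs"
    using *(4) g by (auto simp: comp_def)
  moreover have "step G (\<sigma> x) a (\<sigma> y)" if "Pos x a y \<in> ante \<rho>" for x a y
    using *(3) that by fastforce
  moreover have "\<nexists>r. step G (\<sigma> x) b r" if "Neg x b \<in> ante \<rho>" for x b
    using *(3) that by fastforce
  ultimately show "step G (Op f ps) c q"
    using *(1,2,5,6) g unfolding step.simps(2) by (intro bexI[of _ \<rho>] exI[of _ xs] exI[of _ \<sigma>]) simp_all
qed

definition junk :: "('f, 'a) gsos \<Rightarrow> ('f, 'a) ruloid \<Rightarrow> bool" where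
  "junk G \<rho> \<longleftrightarrow> \<not> (\<exists>p c q. supports G \<rho> p c q)"

definition bisimulation :: "('f, 'a) gsos \<Rightarrow> ('f trm \<times> 'f trm) set \<Rightarrow> bool" where
  "bisimulation G R \<longleftrightarrow>
     R \<subseteq> closed_terms (sig G) \<times> closed_terms (sig G) \<and> sym R \<and>
     (\<forall>p q a p'. (p, q) \<in> R \<and> step G p a p' \<longrightarrow> (\<exists>q'. step G q a q' \<and> (p', q') \<in> R))"

definition bisimilar :: "('f, 'a) gsos \<Rightarrow> 'f trm \<Rightarrow> 'f trm \<Rightarrow> bool" where
  "bisimilar G p q \<longleftrightarrow> (\<exists>R. bisimulation G R \<and> (p, q) \<in> R)"

text \<open>\<open>disjoint_extension G G'\<close>: the language G' is a disjoint extension of G.\<close>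

definition disjoint_extension :: "('f, 'a) gsos \<Rightarrow> ('f, 'a) gsos \<Rightarrow> bool" where
  "disjoint_extension G G' \<longleftrightarrow>
     gsos_language G' \<and> sig G \<subseteq>\<^sub>m sig G' \<and> rules G \<subseteq> rules G' \<and>
     (\<forall>\<rho>\<in>rules G' - rules G. \<forall>f ts. source \<rho> = Op f ts \<longrightarrow> f \<notin> dom (sig G))"

text \<open>Fresh operation symbols of an extension are taken from the type \<open>'f\<close>. At an infinite type
  every disjoint extension of a finite signature is represented, up to the names of the new symbols.\<close>

definition valid_equation :: "('f, 'a) gsos \<Rightarrow> 'f trm \<Rightarrow> 'f trm \<Rightarrow> bool" where
  "valid_equation G P Q \<longleftrightarrow>
     (\<forall>G'. disjoint_extension G G' \<longrightarrow>
        (\<forall>\<sigma>. closed_subst G' \<sigma> \<longrightarrow> bisimilar G' (subst \<sigma> P) (subst \<sigma> Q)))"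

definition sound :: "('f, 'a) gsos \<Rightarrow> ('f, 'a) ruloid \<Rightarrow> bool" where
  "sound G \<rho> \<longleftrightarrow>
     (\<forall>\<sigma>. closed_subst G \<sigma> \<and> (\<forall>\<phi>\<in>ante \<rho>. sat_ante G \<sigma> \<phi>) \<longrightarrow>
        step G (subst \<sigma> (source \<rho>)) (label \<rho>) (subst \<sigma> (target \<rho>)))"

definition supporting :: "('f, 'a) gsos \<Rightarrow> 'f trm \<Rightarrow> 'a \<Rightarrow> ('f, 'a) ruloid set \<Rightarrow> bool" where
  "supporting G D c S \<longleftrightarrow>
     (\<forall>\<rho>\<in>S. source \<rho> = D \<and> label \<rho> = c) \<and>
     (\<forall>\<sigma> p. closed_subst G \<sigma> \<and> step G (subst \<sigma> D) c p \<longrightarrow>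
        (\<exists>\<rho>\<in>S. supports G \<rho> (subst \<sigma> D) c p))"

text \<open>A choice of the sets ruloids(P). The Ruloid Theorem builds these sets from the rules for the
  operations occurring in P, and those are the same in G and in all its disjoint extensions; the
  sets are therefore sound and supporting in every disjoint extension of G, G itself included.
  Requiring this of the transition relation of G alone would admit sets that exploit accidents of
  the closed terms of G: if every transition of G leads to a constant 0, then the ruloid
  \<open>x \<rightarrow>a y / f(x) \<rightarrow>a 0\<close> could stand in for the rule \<open>x \<rightarrow>a y / f(x) \<rightarrow>a y\<close>, and
  rule-matching bisimilarity would not be sound for extensions with further transitions.\<close>

definition ruloid_sets :: "('f, 'a) gsos \<Rightarrow> ('f trm \<Rightarrow> ('f, 'a) ruloid set) \<Rightarrow> bool" where
  "ruloid_sets G ruloids \<longleftrightarrow>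
     (\<forall>P\<in>terms (sig G). \<exists>S. ruloids P = (\<Union>c. S c) \<and>
        (\<forall>c. finite (S c) \<and> (\<forall>\<rho>\<in>S c. ruloid_for (sig G) P \<rho>) \<and>
           (\<forall>G'. disjoint_extension G G' \<longrightarrow>
              (\<forall>\<rho>\<in>S c. sound G' \<rho>) \<and> supporting G' P c (S c))))"

fun rename_ante :: "(var \<Rightarrow> var) \<Rightarrow> 'a antecedent \<Rightarrow> 'a antecedent" where
  "rename_ante \<tau> (Pos x a y) = Pos (\<tau> x) a (\<tau> y)"
| "rename_ante \<tau> (Neg x b) = Neg (\<tau> x) b"

definition rename :: "(var \<Rightarrow> var) \<Rightarrow> ('f, 'a) ruloid \<Rightarrow> ('f, 'a) ruloid" where
  "rename \<tau> \<rho> = \<lparr>ante = rename_ante \<tau> ` ante \<rho>, source = subst (Var \<circ> \<tau>) (source \<rho>),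
                label = label \<rho>, target = subst (Var \<circ> \<tau>) (target \<rho>)\<rparr>"

text \<open>A map on the target variables is extended by the identity to all variables.\<close>

definition valid_ruloid ::
  "('f trm \<Rightarrow> ('f, 'a) ruloid set) \<Rightarrow> 'f trm \<Rightarrow> ('f, 'a) ruloid \<Rightarrow> bool" where
  "valid_ruloid ruloids P \<rho> \<longleftrightarrow>
     source \<rho> = P \<and>
     (\<exists>\<rho>'\<in>ruloids P. \<exists>\<tau>. inj_on \<tau> (targetvars \<rho>') \<and> \<tau> ` targetvars \<rho>' \<inter> sourcevars \<rho> = {} \<and>
        \<rho> = rename (\<lambda>x. if x \<in> targetvars \<rho>' then \<tau> x else x) \<rho>')"

datatype 'a itf = TrueF | Can var 'a | NotF "'a itf" | AndF "'a itf" "'a itf"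

primrec sat :: "('f, 'a) gsos \<Rightarrow> (var \<Rightarrow> 'f trm) \<Rightarrow> 'a itf \<Rightarrow> bool" where
  "sat G \<sigma> TrueF \<longleftrightarrow> True"
| "sat G \<sigma> (Can x a) \<longleftrightarrow> (\<exists>p. step G (\<sigma> x) a p)"
| "sat G \<sigma> (NotF F) \<longleftrightarrow> \<not> sat G \<sigma> F"
| "sat G \<sigma> (AndF F F') \<longleftrightarrow> sat G \<sigma> F \<and> sat G \<sigma> F'"

definition entails :: "('f, 'a) gsos \<Rightarrow> 'a itf \<Rightarrow> 'a itf \<Rightarrow> bool" where
  "entails G F F' \<longleftrightarrow> (\<forall>\<sigma>. closed_subst G \<sigma> \<and> sat G \<sigma> F \<longrightarrow> sat G \<sigma> F')"

text \<open>Conjunction and disjunction of a finite set of formulae, in an arbitrary order.\<close>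

definition Conj :: "'a itf set \<Rightarrow> 'a itf" where
  "Conj \<F> = foldr AndF (SOME Fs. set Fs = \<F>) TrueF"

definition Disj :: "'a itf set \<Rightarrow> 'a itf" where
  "Disj \<F> = NotF (Conj (NotF ` \<F>))"

lemma sat_Conj:
  assumes "finite \<F>"
  shows "sat G \<sigma> (Conj \<F>) \<longleftrightarrow> (\<forall>F\<in>\<F>. sat G \<sigma> F)"
proof -
  have *: "sat G \<sigma> (foldr AndF Fs TrueF) \<longleftrightarrow> (\<forall>F\<in>set Fs. sat G \<sigma> F)" for Fs
    by (induction Fs) simp_all
  have "set (SOME Fs. set Fs = \<F>) = \<F>"
    using finite_list[OF assms] by (rule someI_ex)
  then show ?thesis
    unfolding Conj_def * by (rule arg_cong)
qed

lemma sat_Disj: "finite \<F> \<Longrightarrow> sat G \<sigma> (Disj \<F>) \<longleftrightarrow> (\<exists>F\<in>\<F>. sat G \<sigma> F)"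
  by (simp add: Disj_def sat_Conj)

fun hyp :: "'a antecedent \<Rightarrow> 'a itf" where
  "hyp (Pos x a y) = Can x a"
| "hyp (Neg x b) = NotF (Can x b)"

definition hyps :: "('f, 'a) ruloid \<Rightarrow> 'a itf" where
  "hyps \<rho> = Conj (hyp ` ante \<rho>)"

definition hyps_set :: "('f, 'a) ruloid set \<Rightarrow> 'a itf" where
  "hyps_set J = Disj (hyps ` J)"

definition rm_bisimulation ::
  "('f, 'a) gsos \<Rightarrow> ('f trm \<Rightarrow> ('f, 'a) ruloid set) \<Rightarrow> ('f trm \<times> 'f trm) set \<Rightarrow> bool" where
  "rm_bisimulation G ruloids R \<longleftrightarrow>
     R \<subseteq> terms (sig G) \<times> terms (sig G) \<and> sym R \<and>
     (\<forall>P Q. (P, Q) \<in> R \<longrightarrow>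
       (\<forall>\<rho>\<in>ruloids P. \<exists>J. finite J \<and> (\<forall>\<rho>'\<in>J. valid_ruloid ruloids Q \<rho>') \<and>
          (\<forall>\<rho>'\<in>J.
             label \<rho>' = label \<rho> \<and>
             (target \<rho>, target \<rho>') \<in> R \<and>
             (targetvars \<rho>' \<union> targetvars \<rho>) \<inter> (sourcevars \<rho> \<union> sourcevars \<rho>') = {} \<and>
             (\<forall>y \<in> targetvars \<rho> \<inter> targetvars \<rho>'.
                \<exists>x \<in> sourcevars \<rho> \<inter> sourcevars \<rho>'. \<exists>b. Pos x b y \<in> ante \<rho> \<inter> ante \<rho>')) \<and>
          entails G (hyps \<rho>) (hyps_set J)))"

definition rm_bisimilar ::
  "('f, 'a) gsos \<Rightarrow> ('f trm \<Rightarrow> ('f, 'a) ruloid set) \<Rightarrow> 'f trm \<Rightarrow> 'f trm \<Rightarrow> bool" where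
  "rm_bisimilar G ruloids P Q \<longleftrightarrow> (\<exists>R. rm_bisimulation G ruloids R \<and> (P, Q) \<in> R)"

end

theory Submission
  imports Defs
begin

text \<open>Rule-matching bisimilarity is closed under closed substitutions of an extension as follows: a
  transition of \<open>P\<sigma>\<close> instantiates a ruloid \<open>\<rho>\<close> of P, whose hypotheses depend only on the initial
  actions of the terms substituted for the source variables. Since every set of actions is the set
  of initial actions of some closed term of G, entailment in G carries over to the extension, so
  some matching ruloid \<open>\<rho>'\<close> has its hypotheses satisfied. Its positive antecedents shared with \<open>\<rho>\<close>
  keep their targets, and the remaining target variables are free to be instantiated by any
  witnesses.\<close>

section \<open>Terms, substitutions and closedness\<close>

lemma subst_cong: "(\<And>x. x \<in> vars t \<Longrightarrow> \<sigma> x = \<tau> x) \<Longrightarrow> subst \<sigma> t = subst \<tau> t"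
  by (induction t) auto

text \<open>A supporting ruloid comes with a substitution of its own, known only to yield the same
  source; this recovers its values on the source variables.\<close>

lemma subst_eqD: "subst \<sigma> t = subst \<tau> t \<Longrightarrow> x \<in> vars t \<Longrightarrow> \<sigma> x = \<tau> x"
  by (induction t) auto

lemma subst_subst: "subst \<sigma> (subst \<tau> t) = subst (subst \<sigma> \<circ> \<tau>) t"
  by (induction t) auto

lemma subst_Var: "subst Var t = t"
  by (induction t) (auto intro: map_idI)

lemma vars_subst: "vars (subst \<sigma> t) = (\<Union>x\<in>vars t. vars (\<sigma> x))"
  by (induction t) auto

lemma subst_terms: "t \<in> terms \<Sigma> \<Longrightarrow> (\<And>x. \<sigma> x \<in> terms \<Sigma>) \<Longrightarrow> subst \<sigma> t \<in> terms \<Sigma>"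
  by (induction rule: terms.induct) (auto intro!: terms.intros)

lemma terms_mono:
  assumes "t \<in> terms \<Sigma>" "\<Sigma> \<subseteq>\<^sub>m \<Sigma>'"
  shows "t \<in> terms \<Sigma>'"
  using assms(1)
proof (induction rule: terms.induct)
  case (2 f ts)
  then have "\<Sigma>' f = Some (length ts)"
    using assms(2) by (metis domI map_le_def)
  then show ?case
    using 2 by (auto intro: terms.intros)
qed (rule terms.intros)

lemma subst_closed:
  assumes "closed_subst G \<sigma>" "t \<in> terms (sig G)"
  shows "subst \<sigma> t \<in> closed_terms (sig G)"
  using assms subst_terms[of t "sig G" \<sigma>]
  unfolding closed_subst_def closed_terms_def by (auto simp: vars_subst)

text \<open>The result instantiates the target of a rule by a closed substitution. Transition
  witnesses may therefore serve as values of a closed substitution.\<close>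

lemma step_closed:
  assumes "gsos_language G" "step G p a q"
  shows "q \<in> closed_terms (sig G)"
proof (cases p)
  case (Var x)
  then show ?thesis using assms(2) by simp
next
  case (Op f ps)
  then obtain \<rho> where \<rho>: "\<rho> \<in> rules G" "supports G \<rho> p a q"
    using assms step_iff_supports[of G f ps a q] by auto
  have "target \<rho> \<in> terms (sig G)"
    using assms(1) \<rho>(1) unfolding gsos_language_def gsos_rule_def ruloid_for_def by blast
  then show ?thesis
    using \<rho>(2) subst_closed unfolding supports_def by blast
qed

section \<open>Transferring initial transition formulae between languages\<close>

text \<open>The only atoms are \<open>Can x a\<close>, which test membership of \<open>a\<close> in
  a set \<open>init\<close>.\<close>

lemma sat_cong_init:
  assumes "\<And>x. init G (\<sigma> x) = init G' (\<sigma>' x)"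
  shows "sat G \<sigma> F \<longleftrightarrow> sat G' \<sigma>' F"
proof (induction F)
  case (Can x a)
  then show ?case using assms[of x] unfolding init_def by auto
qed auto

text \<open>This is where the richness of \<open>init\<close> in \<open>G\<close> enters: each
  \<open>\<sigma> x\<close> is replaced by a closed term of \<open>G\<close> with the same initial
  actions, entailment is applied in \<open>G\<close>, and the conclusion is carried back.\<close>

lemma entails_any_language:
  assumes "{init G p | p. p \<in> closed_terms (sig G)} = UNIV" "entails G F F'" "sat G' \<sigma> F"
  shows "sat G' \<sigma> F'"
proof -
  have "\<exists>p. p \<in> closed_terms (sig G) \<and> init G p = init G' (\<sigma> x)" for x
    using assms(1) by (smt (verit) UNIV_I mem_Collect_eq)
  then obtain \<tau> where \<tau>: "\<And>x. \<tau> x \<in> closed_terms (sig G)" "\<And>x. init G (\<tau> x) = init G' (\<sigma> x)"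
    by metis
  then show ?thesis
    using assms(2,3) sat_cong_init[of G \<tau> G' \<sigma>] unfolding entails_def closed_subst_def by blast
qed

lemma sat_hyps:
  assumes "finite (ante \<rho>)"
  shows "sat G \<sigma> (hyps \<rho>) \<longleftrightarrow>
    (\<forall>x a y. Pos x a y \<in> ante \<rho> \<longrightarrow> (\<exists>q. step G (\<sigma> x) a q)) \<and>
    (\<forall>x b. Neg x b \<in> ante \<rho> \<longrightarrow> (\<nexists>q. step G (\<sigma> x) b q))"
proof -
  have *: "sat G \<sigma> (hyps \<rho>) \<longleftrightarrow> (\<forall>\<phi>\<in>ante \<rho>. sat G \<sigma> (hyp \<phi>))"
    using assms by (simp add: hyps_def sat_Conj)
  show ?thesis
    unfolding * by (auto, metis antecedent.exhaust hyp.simps sat.simps(2,3))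
qed

lemma sat_ante_all:
  "(\<forall>\<phi>\<in>ante \<rho>. sat_ante G \<sigma> \<phi>) \<longleftrightarrow>
    (\<forall>x a y. Pos x a y \<in> ante \<rho> \<longrightarrow> step G (\<sigma> x) a (\<sigma> y)) \<and>
    (\<forall>x b. Neg x b \<in> ante \<rho> \<longrightarrow> (\<nexists>q. step G (\<sigma> x) b q))"
  by (auto, metis antecedent.exhaust sat_ante.simps)

section \<open>Renaming ruloids\<close>

lemma Pos_rename: "Pos x a y \<in> rename_ante \<tau> ` H \<longleftrightarrow> (\<exists>u v. Pos u a v \<in> H \<and> x = \<tau> u \<and> y = \<tau> v)"
proof
  assume "Pos x a y \<in> rename_ante \<tau> ` H"
  then obtain \<phi> where "\<phi> \<in> H" "Pos x a y = rename_ante \<tau> \<phi>" by auto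
  then show "\<exists>u v. Pos u a v \<in> H \<and> x = \<tau> u \<and> y = \<tau> v" by (cases \<phi>) auto
qed (force intro: rev_image_eqI)

lemma Neg_rename: "Neg x b \<in> rename_ante \<tau> ` H \<longleftrightarrow> (\<exists>u. Neg u b \<in> H \<and> x = \<tau> u)"
proof
  assume "Neg x b \<in> rename_ante \<tau> ` H"
  then obtain \<phi> where "\<phi> \<in> H" "Neg x b = rename_ante \<tau> \<phi>" by auto
  then show "\<exists>u. Neg u b \<in> H \<and> x = \<tau> u" by (cases \<phi>) auto
qed (force intro: rev_image_eqI)

text \<open>A substitution \<open>\<sigma>\<close> satisfies the renamed antecedents exactly when
  \<open>\<sigma> \<circ> \<tau>\<close> satisfies the original ones.\<close>

lemma sound_rename:
  assumes "sound G \<rho>"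
  shows "sound G (rename \<tau> \<rho>)"
  unfolding sound_def
proof (intro allI impI)
  fix \<sigma>
  assume *: "closed_subst G \<sigma> \<and> (\<forall>\<phi>\<in>ante (rename \<tau> \<rho>). sat_ante G \<sigma> \<phi>)"
  have "sat_ante G (\<sigma> \<circ> \<tau>) \<phi> \<longleftrightarrow> sat_ante G \<sigma> (rename_ante \<tau> \<phi>)" for \<phi>
    by (cases \<phi>) simp_all
  then have "\<forall>\<phi>\<in>ante \<rho>. sat_ante G (\<sigma> \<circ> \<tau>) \<phi>"
    using * unfolding rename_def by auto
  moreover have "closed_subst G (\<sigma> \<circ> \<tau>)"
    using * unfolding closed_subst_def by simp
  ultimately have "step G (subst (\<sigma> \<circ> \<tau>) (source \<rho>)) (label \<rho>) (subst (\<sigma> \<circ> \<tau>) (target \<rho>))"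
    using assms unfolding sound_def by blast
  moreover have "subst \<sigma> \<circ> (Var \<circ> \<tau>) = \<sigma> \<circ> \<tau>"
    by auto
  ultimately show "step G (subst \<sigma> (source (rename \<tau> \<rho>))) (label (rename \<tau> \<rho>))
      (subst \<sigma> (target (rename \<tau> \<rho>)))"
    by (simp add: rename_def subst_subst)
qed

text \<open>Joint injectivity on source and target variables keeps target variables distinct from
  one another and from the fixed source variables.\<close>

lemma ruloid_for_rename:
  assumes \<rho>: "ruloid_for \<Sigma> D \<rho>"
    and fix_source: "\<And>x. x \<in> vars D \<Longrightarrow> \<tau> x = x"
    and inj: "inj_on \<tau> (vars D \<union> targetvars \<rho>)"
  shows "ruloid_for \<Sigma> D (rename \<tau> \<rho>)"
proof -
  let ?\<rho> = "rename \<tau> \<rho>"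
  have D: "source \<rho> = D" "sourcevars \<rho> = vars D"
    using \<rho> by (simp_all add: ruloid_for_def sourcevars_def)
  have src: "source ?\<rho> = D"
    using D(1) fix_source subst_cong[of D "Var \<circ> \<tau>" Var] by (simp add: rename_def subst_Var)
  have sv: "sourcevars ?\<rho> = vars D"
    by (simp add: sourcevars_def src)
  have tv: "targetvars ?\<rho> = \<tau> ` targetvars \<rho>"
    unfolding targetvars_def by (auto simp: rename_def Pos_rename)
  have Pos_vars: "x \<in> vars D" "y \<in> targetvars \<rho>" if "Pos x a y \<in> ante \<rho>" for x a y
    using \<rho> D that unfolding ruloid_for_def targetvars_def by blast+
  have Neg_vars: "x \<in> vars D" if "Neg x b \<in> ante \<rho>" for x b
    using \<rho> D that unfolding ruloid_for_def by blast
  have disj: "vars D \<inter> targetvars \<rho> = {}"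
    using \<rho> D unfolding ruloid_for_def by blast
  have "vars (target ?\<rho>) = \<tau> ` vars (target \<rho>)"
    by (auto simp: rename_def vars_subst)
  moreover have "vars (target \<rho>) \<subseteq> vars D \<union> targetvars \<rho>"
    using \<rho> D unfolding ruloid_for_def by simp
  ultimately have tgt: "vars (target ?\<rho>) \<subseteq> vars D \<union> targetvars ?\<rho>"
    using fix_source unfolding tv by force
  have "target ?\<rho> \<in> terms \<Sigma>"
    using \<rho> by (simp add: ruloid_for_def rename_def subst_terms terms.intros(1))
  moreover have "finite (ante ?\<rho>)" "D \<in> terms \<Sigma>"
    using \<rho> unfolding ruloid_for_def rename_def by auto
  moreover have "x \<in> vars D" if "Pos x a y \<in> ante ?\<rho>" for x a y
    using that Pos_vars fix_source by (auto simp: rename_def Pos_rename)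
  moreover have "x \<in> vars D" if "Neg x b \<in> ante ?\<rho>" for x b
    using that Neg_vars fix_source by (auto simp: rename_def Neg_rename)
  moreover have "targetvars ?\<rho> \<inter> vars D = {}"
  proof -
    \<comment> \<open>Equality would give \<open>\<tau> y = \<tau> x\<close>, hence
      \<open>y = x\<close>, a variable that is both source and target.\<close>
    have "\<tau> y \<noteq> x" if "y \<in> targetvars \<rho>" "x \<in> vars D" for x y
      using that inj disj fix_source[of x] unfolding inj_on_def
      by (metis IntI UnI1 UnI2 empty_iff)
    then show ?thesis unfolding tv by blast
  qed
  moreover have "x = x' \<and> a = a'" if pos: "Pos x a y \<in> ante ?\<rho>" "Pos x' a' y \<in> ante ?\<rho>" for x a x' a' y
  proof -
    obtain u v u' v' where uv: "Pos u a v \<in> ante \<rho>" "Pos u' a' v' \<in> ante \<rho>"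
      and eq: "x = \<tau> u" "x' = \<tau> u'" "\<tau> v = \<tau> v'"
      using pos by (auto simp: rename_def Pos_rename)
    have "v = v'"
      using inj eq(3) Pos_vars(2)[OF uv(1)] Pos_vars(2)[OF uv(2)] unfolding inj_on_def by blast
    then have "u = u' \<and> a = a'"
      using \<rho> uv unfolding ruloid_for_def by blast
    then show ?thesis using eq by simp
  qed
  ultimately show ?thesis
    unfolding ruloid_for_def sv using src tgt by blast
qed

lemma valid_ruloidD:
  assumes rs: "ruloid_sets G ruloids" and ext: "disjoint_extension G G'"
    and Q: "Q \<in> terms (sig G)" and valid: "valid_ruloid ruloids Q \<rho>"
  shows "ruloid_for (sig G) Q \<rho>" "sound G' \<rho>"
proof -
  obtain \<rho>0 \<tau> where \<rho>0: "\<rho>0 \<in> ruloids Q" and inj: "inj_on \<tau> (targetvars \<rho>0)"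
    and disj: "\<tau> ` targetvars \<rho>0 \<inter> sourcevars \<rho> = {}" and src: "source \<rho> = Q"
    and \<rho>: "\<rho> = rename (\<lambda>x. if x \<in> targetvars \<rho>0 then \<tau> x else x) \<rho>0"
    using valid unfolding valid_ruloid_def by blast
  have r: "ruloid_for (sig G) Q \<rho>0" "sound G' \<rho>0"
    using rs Q \<rho>0 ext unfolding ruloid_sets_def by blast+
  have fresh: "targetvars \<rho>0 \<inter> vars Q = {}"
    using r(1) unfolding ruloid_for_def sourcevars_def by blast
  have "\<tau> ` targetvars \<rho>0 \<inter> vars Q = {}"
    using disj src by (simp add: sourcevars_def)
  \<comment> \<open>The images of the target variables avoid \<open>vars Q\<close>, so extending
    \<open>\<tau>\<close> by the identity creates no collision.\<close>
  then have "inj_on (\<lambda>x. if x \<in> targetvars \<rho>0 then \<tau> x else x) (vars Q \<union> targetvars \<rho>0)"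
    using inj fresh unfolding inj_on_def by auto
  then show "ruloid_for (sig G) Q \<rho>"
    unfolding \<rho> using r(1) fresh by (intro ruloid_for_rename) auto
  show "sound G' \<rho>"
    unfolding \<rho> by (rule sound_rename) (rule r(2))
qed

section \<open>Matching transitions in a disjoint extension\<close>

text \<open>The targets may contain the target variables of both ruloids, so the derivatives
  instantiate a pair in \<open>R\<close> by a new common substitution \<open>\<tau>\<close> instead
  of \<open>\<sigma>\<close>.\<close>

lemma rm_bisimulation_step:
  assumes rs: "ruloid_sets G ruloids" and ext: "disjoint_extension G G'"
    and init: "{init G p | p. p \<in> closed_terms (sig G)} = UNIV"
    and R: "rm_bisimulation G ruloids R" "(P, Q) \<in> R"
    and \<sigma>: "closed_subst G' \<sigma>" and st: "step G' (subst \<sigma> P) a p'"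
  shows "\<exists>\<tau> P' Q'. closed_subst G' \<tau> \<and> (P', Q') \<in> R \<and> p' = subst \<tau> P' \<and>
    step G' (subst \<sigma> Q) a (subst \<tau> Q')"
proof -
  have PQ: "P \<in> terms (sig G)" "Q \<in> terms (sig G)"
    using R unfolding rm_bisimulation_def by auto
  have G': "gsos_language G'"
    using ext unfolding disjoint_extension_def by blast
  obtain S where S: "ruloids P = (\<Union>c. S c)" "\<And>\<rho> c. \<rho> \<in> S c \<Longrightarrow> ruloid_for (sig G) P \<rho>"
    "supporting G' P a (S a)"
    using rs PQ(1) ext unfolding ruloid_sets_def by meson
  obtain \<rho> where \<rho>S: "\<rho> \<in> S a" and supp: "supports G' \<rho> (subst \<sigma> P) a p'"
    using S(3) \<sigma> st unfolding supporting_def by blast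
  have \<rho>: "\<rho> \<in> ruloids P" "ruloid_for (sig G) P \<rho>"
    using \<rho>S S by auto
  then have sv: "source \<rho> = P" "sourcevars \<rho> = vars P"
    by (auto simp: ruloid_for_def sourcevars_def)
  \<comment> \<open>\<open>\<sigma>1\<close> agrees with \<open>\<sigma>\<close> on
    \<open>vars P\<close> and also records the targets of the positive antecedents of
    \<open>\<rho>\<close>.\<close>
  obtain \<sigma>1 where \<sigma>1: "closed_subst G' \<sigma>1" "\<forall>\<phi>\<in>ante \<rho>. sat_ante G' \<sigma>1 \<phi>"
      "subst \<sigma> P = subst \<sigma>1 P" "a = label \<rho>" "p' = subst \<sigma>1 (target \<rho>)"
    using supp sv unfolding supports_def by auto
  have agree: "\<sigma> x = \<sigma>1 x" if "x \<in> vars P" for x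
    using subst_eqD \<sigma>1(3) that by metis
  obtain J where J: "finite J" "\<forall>\<rho>'\<in>J. valid_ruloid ruloids Q \<rho>'"
    "\<forall>\<rho>'\<in>J. label \<rho>' = label \<rho> \<and> (target \<rho>, target \<rho>') \<in> R \<and>
       (targetvars \<rho>' \<union> targetvars \<rho>) \<inter> (sourcevars \<rho> \<union> sourcevars \<rho>') = {} \<and>
       (\<forall>y \<in> targetvars \<rho> \<inter> targetvars \<rho>'.
          \<exists>x \<in> sourcevars \<rho> \<inter> sourcevars \<rho>'. \<exists>b. Pos x b y \<in> ante \<rho> \<inter> ante \<rho>')"
    "entails G (hyps \<rho>) (hyps_set J)"
    using R(1)[unfolded rm_bisimulation_def, THEN conjunct2, THEN conjunct2, rule_format, OF R(2) \<rho>(1)]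
    by (elim exE conjE) (rule that)
  \<comment> \<open>The values of \<open>\<sigma>\<close> are kept on all source variables, those of
    \<open>\<sigma>1\<close> elsewhere. On \<open>vars P\<close> the two coincide, so the hypotheses
    of \<open>\<rho>\<close> still hold.\<close>
  define \<sigma>2 where "\<sigma>2 x = (if x \<in> vars P \<union> vars Q then \<sigma> x else \<sigma>1 x)" for x
  have Pos_P: "x \<in> vars P" "y \<in> targetvars \<rho>" if "Pos x b y \<in> ante \<rho>" for x b y
    using \<rho>(2) that sv unfolding ruloid_for_def targetvars_def by blast+
  have Neg_P: "x \<in> vars P" if "Neg x b \<in> ante \<rho>" for x b
    using \<rho>(2) that sv unfolding ruloid_for_def by blast
  have \<sigma>2_P: "\<sigma>2 x = \<sigma>1 x" if "x \<in> vars P" for x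
    using that agree by (simp add: \<sigma>2_def)
  have "finite (ante \<rho>)"
    using \<rho>(2) unfolding ruloid_for_def by blast
  then have "sat G' \<sigma>2 (hyps \<rho>)"
    using \<sigma>1(2) Pos_P Neg_P \<sigma>2_P unfolding sat_ante_all by (simp add: sat_hyps) metis
  then have "sat G' \<sigma>2 (hyps_set J)"
    using entails_any_language[OF init J(4)] by blast
  then obtain \<rho>' where \<rho>'J: "\<rho>' \<in> J" and sat': "sat G' \<sigma>2 (hyps \<rho>')"
    using J(1) unfolding hyps_set_def by (auto simp: sat_Disj)
  have \<rho>': "ruloid_for (sig G) Q \<rho>'" "sound G' \<rho>'"
    using valid_ruloidD[OF rs ext PQ(2) bspec[OF J(2) \<rho>'J]] by blast+
  then have sv': "source \<rho>' = Q" "sourcevars \<rho>' = vars Q"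
    by (auto simp: ruloid_for_def sourcevars_def)
  have fresh: "(targetvars \<rho>' \<union> targetvars \<rho>) \<inter> (vars P \<union> vars Q) = {}"
    using bspec[OF J(3) \<rho>'J] unfolding sv(2) sv'(2) by blast
  have shared: "\<exists>x\<in>vars P. \<exists>b. Pos x b y \<in> ante \<rho> \<inter> ante \<rho>'"
    if "y \<in> targetvars \<rho>" "y \<in> targetvars \<rho>'" for y
    using bspec[OF J(3) \<rho>'J] that unfolding sv(2) by blast
  have uniq: "x = x' \<and> b = b'" if "Pos x b y \<in> ante \<rho>'" "Pos x' b' y \<in> ante \<rho>'" for x b x' b' y
    using \<rho>'(1) that unfolding ruloid_for_def by blast
  have Pos_Q: "x \<in> vars Q" "y \<in> targetvars \<rho>'" if "Pos x b y \<in> ante \<rho>'" for x b y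
    using \<rho>'(1) that sv' unfolding ruloid_for_def targetvars_def by blast+
  have Neg_Q: "x \<in> vars Q" if "Neg x b \<in> ante \<rho>'" for x b
    using \<rho>'(1) that sv' unfolding ruloid_for_def by blast
  have "finite (ante \<rho>')"
    using \<rho>'(1) unfolding ruloid_for_def by blast
  note hyps' = sat'[unfolded sat_hyps[OF this]]
  \<comment> \<open>A target variable determines its positive antecedent, so one witness per
    variable suffices.\<close>
  have "\<exists>q. q \<in> closed_terms (sig G') \<and> (\<forall>x b. Pos x b y \<in> ante \<rho>' \<longrightarrow> step G' (\<sigma>2 x) b q)"
    if y: "y \<in> targetvars \<rho>'" for y
  proof -
    obtain x b where "Pos x b y \<in> ante \<rho>'"
      using y unfolding targetvars_def by blast
    then show ?thesis
      using hyps' uniq step_closed[OF G'] by metis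
  qed
  then obtain w where w: "\<And>y. y \<in> targetvars \<rho>' \<Longrightarrow> w y \<in> closed_terms (sig G')"
    "\<And>x b y. Pos x b y \<in> ante \<rho>' \<Longrightarrow> step G' (\<sigma>2 x) b (w y)"
    using Pos_Q(2) by metis
  \<comment> \<open>Only target variables exclusive to \<open>\<rho>'\<close> get new witnesses;
    shared ones keep their value under \<open>\<sigma>1\<close>, on which \<open>p'\<close> may
    depend.\<close>
  define \<tau> where "\<tau> y = (if y \<in> targetvars \<rho>' - targetvars \<rho> then w y else \<sigma>2 y)" for y
  have closed: "closed_subst G' \<tau>"
    using \<sigma> \<sigma>1(1) w(1) unfolding closed_subst_def \<tau>_def \<sigma>2_def by simp
  have \<tau>_src: "\<tau> x = \<sigma>2 x" if "x \<in> vars P \<union> vars Q" for x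
    using that fresh unfolding \<tau>_def by auto
  have \<tau>_tgt: "\<tau> y = \<sigma>1 y" if "y \<in> targetvars \<rho>" for y
    using that fresh unfolding \<tau>_def \<sigma>2_def by auto
  have step': "step G' (\<tau> x) b (\<tau> y)" if pos: "Pos x b y \<in> ante \<rho>'" for x b y
  proof (cases "y \<in> targetvars \<rho>")
    case True
    \<comment> \<open>Condition (d) provides an antecedent with target \<open>y\<close> common to
      both ruloids; uniqueness within \<open>\<rho>'\<close> identifies it with the given one, whose
      transition \<open>\<sigma>1\<close> already provides.\<close>
    then have "Pos x b y \<in> ante \<rho>" "x \<in> vars P"
      using shared[OF True Pos_Q(2)[OF pos]] uniq[OF pos] by auto
    then show ?thesis
      using \<sigma>1(2) \<tau>_tgt[OF True] \<tau>_src[of x] \<sigma>2_P[of x] by fastforce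
  next
    case False
    then have "\<tau> y = w y"
      using Pos_Q(2)[OF pos] by (simp add: \<tau>_def)
    then show ?thesis
      using w(2)[OF pos] \<tau>_src[of x] Pos_Q(1)[OF pos] by simp
  qed
  have "\<forall>\<phi>\<in>ante \<rho>'. sat_ante G' \<tau> \<phi>"
    unfolding sat_ante_all using step' hyps' Neg_Q \<tau>_src by (metis UnI2)
  then have "step G' (subst \<tau> Q) (label \<rho>') (subst \<tau> (target \<rho>'))"
    using \<rho>'(2) closed sv'(1) unfolding sound_def by blast
  moreover have "subst \<tau> Q = subst \<sigma> Q"
    using \<tau>_src by (intro subst_cong) (simp add: \<sigma>2_def)
  moreover have "subst \<tau> (target \<rho>) = p'"
    unfolding \<sigma>1(5)
  proof (rule subst_cong)
    fix x
    assume "x \<in> vars (target \<rho>)"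
    then have "x \<in> vars P \<union> targetvars \<rho>"
      using \<rho>(2) sv(2) unfolding ruloid_for_def by blast
    then show "\<tau> x = \<sigma>1 x"
      using \<tau>_tgt \<tau>_src[of x] \<sigma>2_P by auto
  qed
  ultimately show ?thesis
    using closed bspec[OF J(3) \<rho>'J] \<sigma>1(4) by metis
qed

theorem theorem5p2:
  fixes G :: "('f, 'a::finite) gsos"
    and ruloids :: "'f trm \<Rightarrow> ('f, 'a) ruloid set"
    and P Q :: "'f trm"
  assumes "gsos_language G"
    and "ruloid_sets G ruloids"
    and "\<forall>\<rho>\<in>rules G. \<not> junk G \<rho>"
    and "\<forall>D\<in>terms (sig G). \<forall>\<rho>\<in>ruloids D. \<not> junk G \<rho>"
    and "{init G p | p. p \<in> closed_terms (sig G)} = Pow (UNIV :: 'a set)"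
    and "P \<in> terms (sig G)" and "Q \<in> terms (sig G)"
    and "rm_bisimilar G ruloids P Q"
  shows "valid_equation G P Q"
  unfolding valid_equation_def
proof (intro allI impI)
  fix G' \<sigma>
  assume ext: "disjoint_extension G G'" and \<sigma>: "closed_subst G' \<sigma>"
  obtain R where R: "rm_bisimulation G ruloids R" "(P, Q) \<in> R"
    using assms(8) unfolding rm_bisimilar_def by blast
  have init: "{init G p | p. p \<in> closed_terms (sig G)} = UNIV"
    using assms(5) by simp
  define B where "B = {(subst \<tau> P', subst \<tau> Q') | \<tau> P' Q'. closed_subst G' \<tau> \<and> (P', Q') \<in> R}"
  have "subst \<tau> P' \<in> closed_terms (sig G')" if "closed_subst G' \<tau>" "P' \<in> terms (sig G)" for \<tau> P'
    using that ext subst_closed terms_mono unfolding disjoint_extension_def by blast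
  then have "B \<subseteq> closed_terms (sig G') \<times> closed_terms (sig G')"
    using R(1) unfolding B_def rm_bisimulation_def by blast
  moreover have "sym B"
    using R(1) unfolding B_def rm_bisimulation_def sym_def by blast
  moreover have "\<exists>q'. step G' q a q' \<and> (p', q') \<in> B" if pq: "(p, q) \<in> B" "step G' p a p'" for p q a p'
  proof -
    obtain \<tau> P' Q' where "closed_subst G' \<tau>" "(P', Q') \<in> R" "p = subst \<tau> P'" "q = subst \<tau> Q'"
      using pq(1) unfolding B_def by blast
    then show ?thesis
      using rm_bisimulation_step[OF assms(2) ext init R(1), of P' Q' \<tau> a p'] pq(2)
      unfolding B_def by blast
  qed
  ultimately have "bisimulation G' B"
    unfolding bisimulation_def by blast
  then show "bisimilar G' (subst \<sigma> P) (subst \<sigma> Q)"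
    using \<sigma> R(2) unfolding bisimilar_def B_def by blast
qed

end
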